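(* Let $\mathcal{A}=\{a_1,\ldots,a_c\}$ be a finite alphabet of size $c\ge 2$, let $\boldsymbol{X}_n=(X_1,\ldots,X_n)$ be an exchangeable sequence of random variables with values in $\mathcal{A}$, and let $\mu$ denote the law of the empirical measure of $\boldsymbol{X}_n$, i.e. $\mu(\boldsymbol{p})=\mathbb{P}(\mathcal{T}_n(\boldsymbol{X}_n)=\boldsymbol{p})$ for p.m.f.s $\boldsymbol{p}$ on $\mathcal{A}$. For $1\le k\le n$, let $P_k$ be the joint p.m.f. of $(X_1,\ldots,X_k)$ and let $M_{k,\mu}$ be the mixture of i.i.d. distributions $M_{k,\mu}(\boldsymbol{z})=\sum_{\boldsymbol{p}}\mu(\boldsymbol{p})\,\boldsymbol{p}^k(\boldsymbol{z})$, $\boldsymbol{z}\in\mathcal{A}^k$. Then for any $1\le k\le n$, $$D(P_k\|M_{k,\mu})\le\sum_{\boldsymbol{p}}\mu(\boldsymbol{p})\,D(n,k,n\boldsymbol{p})\le\max_{\boldsymbol{\ell}/n\,\in\,\mathrm{supp}(\mu)}D(n,k,\boldsymbol{\ell}),$$ where the maximum is over all p.m.f.s of the form $\boldsymbol{\ell}/n$ in the support of $\mu$.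
   Context: Exchangeable means that $(X_{\pi(1)},\ldots,X_{\pi(n)})$ has the same distribution as $(X_1,\ldots,X_n)$ for every permutation $\pi$ of $\{1,\ldots,n\}$. The type $\mathcal{T}_m(\boldsymbol{y})$ of $\boldsymbol{y}\in\mathcal{A}^m$ is the vector of empirical frequencies, whose $r$th component is $\frac1m\sum_{i=1}^m\mathbb{I}(y_i=a_r)$, $1\le r\le c$. A p.m.f. $\boldsymbol{p}$ on $\mathcal{A}$ is identified with the vector $(\boldsymbol{p}(a_1),\ldots,\boldsymbol{p}(a_c))$, and $\boldsymbol{p}^k(\boldsymbol{z})=\prod_{j=1}^k\boldsymbol{p}(z_j)$. The measure $\mu$ is supported on finitely many p.m.f.s, all of the form $\boldsymbol{\ell}/n$ with $\boldsymbol{\ell}$ a vector of nonnegative integers summing to $n$. For p.m.f.s $P,Q$ on a finite set, $D(P\|Q)=\sum_x P(x)\log(P(x)/Q(x))$ is the relative entropy (natural logarithm, $0\log 0=0$). For a vector $\boldsymbol{\ell}=(\ell_1,\ldots,\ell_c)$ of nonnegative integers with sum $n$, $D(n,k,\boldsymbol{\ell})=D(H(n,k,\boldsymbol{\ell};\cdot)\,\|\,B(n,k,\boldsymbol{\ell};\cdot))$, where $$H(n,k,\boldsymbol{\ell};\boldsymbol{s})=\frac{\prod_{i=1}^c\binom{\ell_i}{s_i}}{\binom{n}{k}}$$ for integer vectors $\boldsymbol{s}$ with $0\le s_i\le\ell_i$, $\sum_i s_i=k$ (and $0$ for other $\boldsymbol{s}$), and $$B(n,k,\boldsymbol{\ell};\boldsymbol{s})=\frac{k!}{\prod_{i=1}^c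 s_i!}\prod_{i=1}^c\left(\frac{\ell_i}{n}\right)^{s_i}$$ for integer vectors $\boldsymbol{s}$ with $s_i\ge0$, $\sum_i s_i=k$ (with $0^0=1$). *)

theory Defs
  imports "HOL-Probability.Probability"
begin

text \<open>The alphabet is (the universe of) a finite type \<open>'a\<close>; vectors with \<open>c\<close> components are
  functions on \<open>'a\<close>, the component of index \<open>r\<close> being the value at the letter \<open>a\<^sub>r\<close>.
  Sequences are functions on the index set \<open>{1..n}\<close>.\<close>

definition exchangeable :: "'w measure \<Rightarrow> nat \<Rightarrow> (nat \<Rightarrow> 'w \<Rightarrow> 'a) \<Rightarrow> bool" where
  "exchangeable M n X \<longleftrightarrow>
    (\<forall>\<pi>. \<pi> permutes {1..n} \<longrightarrow>
      distr M (PiM {1..n} (\<lambda>_. count_space UNIV)) (\<lambda>\<omega>. \<lambda>i\<in>{1..n}. X (\<pi> i) \<omega>) =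
      distr M (PiM {1..n} (\<lambda>_. count_space UNIV)) (\<lambda>\<omega>. \<lambda>i\<in>{1..n}. X i \<omega>))"

definition type_of_seq :: "nat \<Rightarrow> (nat \<Rightarrow> 'a) \<Rightarrow> 'a \<Rightarrow> real" where
  "type_of_seq m y = (\<lambda>a. (1 / real m) * (\<Sum>i=1..m. of_bool (y i = a)))"

definition empirical_law :: "'w measure \<Rightarrow> nat \<Rightarrow> (nat \<Rightarrow> 'w \<Rightarrow> 'a) \<Rightarrow> 'a pmf \<Rightarrow> real" where
  "empirical_law M n X p = measure M {\<omega> \<in> space M. type_of_seq n (\<lambda>i. X i \<omega>) = pmf p}"

definition mass_supp :: "('b \<Rightarrow> real) \<Rightarrow> 'b set" where
  "mass_supp \<mu> = {p. \<mu> p \<noteq> 0}"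

definition joint_pmf :: "'w measure \<Rightarrow> (nat \<Rightarrow> 'w \<Rightarrow> 'a) \<Rightarrow> nat \<Rightarrow> (nat \<Rightarrow> 'a) \<Rightarrow> real" where
  "joint_pmf M X k z = measure M {\<omega> \<in> space M. \<forall>i\<in>{1..k}. X i \<omega> = z i}"

text \<open>The sum ranges over the support of \<open>\<mu>\<close>, which is finite for empirical laws
  (lemma \<open>finite_mass_supp_empirical_law\<close>).\<close>

definition iid_mixture :: "nat \<Rightarrow> ('a pmf \<Rightarrow> real) \<Rightarrow> (nat \<Rightarrow> 'a) \<Rightarrow> real" where
  "iid_mixture k \<mu> z = (\<Sum>p\<in>mass_supp \<mu>. \<mu> p * (\<Prod>j=1..k. pmf p (z j)))"

text \<open>Relative entropy on a finite set \<open>S\<close> takes the value \<open>\<infinity>\<close> if \<open>P\<close> is not absolutely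
  continuous with respect to \<open>Q\<close>; the totalised real expression would give the summand \<open>0\<close> there,
  since \<open>x / 0 = 0\<close> and \<open>ln 0 = 0\<close>.\<close>

definition rel_entropy :: "'b set \<Rightarrow> ('b \<Rightarrow> real) \<Rightarrow> ('b \<Rightarrow> real) \<Rightarrow> ereal" where
  "rel_entropy S P Q =
    (if \<exists>x\<in>S. P x \<noteq> 0 \<and> Q x = 0 then \<infinity>
     else ereal (\<Sum>x\<in>S. P x * ln (P x / Q x)))"

definition hypergeom :: "nat \<Rightarrow> nat \<Rightarrow> ('a::finite \<Rightarrow> nat) \<Rightarrow> ('a \<Rightarrow> nat) \<Rightarrow> real" where
  "hypergeom n k l s =
    (if (\<forall>a. s a \<le> l a) \<and> (\<Sum>a\<in>UNIV. s a) = k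
     then (\<Prod>a\<in>UNIV. real (l a choose s a)) / real (n choose k) else 0)"

definition multinom :: "nat \<Rightarrow> nat \<Rightarrow> ('a::finite \<Rightarrow> nat) \<Rightarrow> ('a \<Rightarrow> nat) \<Rightarrow> real" where
  "multinom n k l s =
    (if (\<Sum>a\<in>UNIV. s a) = k
     then fact k / (\<Prod>a\<in>UNIV. fact (s a)) * (\<Prod>a\<in>UNIV. (real (l a) / real n) ^ s a) else 0)"

definition D_hyp_mult :: "nat \<Rightarrow> nat \<Rightarrow> ('a::finite \<Rightarrow> nat) \<Rightarrow> ereal" where
  "D_hyp_mult n k l = rel_entropy {s. (\<Sum>a\<in>UNIV. s a) = k} (hypergeom n k l) (multinom n k l)"

text \<open>The integer vector \<open>n p\<close>. The floor is only a type conversion for \<open>p\<close> in the support of an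
  empirical law (lemma \<open>scaled_vec_exact\<close>).\<close>

definition scaled_vec :: "nat \<Rightarrow> 'a pmf \<Rightarrow> 'a \<Rightarrow> nat" where
  "scaled_vec n p = (\<lambda>a. nat \<lfloor>real n * pmf p a\<rfloor>)"

definition supp_counts :: "nat \<Rightarrow> ('a pmf \<Rightarrow> real) \<Rightarrow> ('a \<Rightarrow> nat) set" where
  "supp_counts n \<mu> = {l. \<exists>p\<in>mass_supp \<mu>. \<forall>a. pmf p a = real (l a) / real n}"

lemma mass_supp_empirical_lawE:
  assumes "p \<in> mass_supp (empirical_law M n X)"
  obtains \<omega> where "\<omega> \<in> space M" "pmf p = type_of_seq n (\<lambda>i. X i \<omega>)"
proof -
  have "{\<omega> \<in> space M. type_of_seq n (\<lambda>i. X i \<omega>) = pmf p} \<noteq> {}"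
    using assms unfolding mass_supp_def empirical_law_def by (metis (lifting) measure_empty mem_Collect_eq)
  then show thesis using that by fastforce
qed

lemma type_of_seq_count: "type_of_seq n y a = real (card {i\<in>{1..n}. y i = a}) / real n"
proof -
  have "{i\<in>{1..n}. y i = a} = {1..n} \<inter> {i. y i = a}" by auto
  then show ?thesis by (simp add: type_of_seq_def sum.If_cases of_bool_def)
qed

lemma scaled_vec_exact:
  assumes "n > 0" "p \<in> mass_supp (empirical_law M n X)"
  shows "real (scaled_vec n p a) = real n * pmf p a"
proof -
  obtain \<omega> where "pmf p = type_of_seq n (\<lambda>i. X i \<omega>)"
    using assms(2) by (rule mass_supp_empirical_lawE)
  then have "real n * pmf p a = real (card {i\<in>{1..n}. X i \<omega> = a})"
    using assms(1) by (simp add: type_of_seq_count)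
  then show ?thesis unfolding scaled_vec_def by (metis floor_of_nat nat_int)
qed

lemma finite_mass_supp_empirical_law:
  fixes X :: "nat \<Rightarrow> 'w \<Rightarrow> 'a::finite"
  shows "finite (mass_supp (empirical_law M n X))"
proof -
  have fin: "finite {f::'a \<Rightarrow> real. \<forall>a. (a \<in> UNIV \<longrightarrow> f a \<in> (\<lambda>j. real j / real n) ` {..n}) \<and> (a \<notin> UNIV \<longrightarrow> f a = 0)}"
    by (rule finite_set_of_finite_funs) auto
  have "pmf p a \<in> (\<lambda>j. real j / real n) ` {..n}"
    if p: "p \<in> mass_supp (empirical_law M n X)" for p a
  proof -
    obtain \<omega> where "pmf p = type_of_seq n (\<lambda>i. X i \<omega>)"
      using p by (rule mass_supp_empirical_lawE)
    moreover have "card {i\<in>{1..n}. X i \<omega> = a} \<le> card {1..n}" by (rule card_mono) auto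
    ultimately show ?thesis by (auto simp: type_of_seq_count)
  qed
  then have "pmf ` mass_supp (empirical_law M n X) \<subseteq>
      {f. \<forall>a. (a \<in> UNIV \<longrightarrow> f a \<in> (\<lambda>j. real j / real n) ` {..n}) \<and> (a \<notin> UNIV \<longrightarrow> f a = 0)}"
    by auto
  then have "finite (pmf ` mass_supp (empirical_law M n X))" by (rule finite_subset[OF _ fin])
  moreover have "inj_on pmf (mass_supp (empirical_law M n X))"
    by (auto intro!: inj_onI pmf_eqI)
  ultimately show ?thesis by (rule finite_imageD)
qed

lemma supp_counts_empirical_law:
  assumes "n > 0"
  shows "supp_counts n (empirical_law M n X) = scaled_vec n ` mass_supp (empirical_law M n X)"
    (is "?L = ?R")
proof
  show "?L \<subseteq> ?R"
  proof
    fix l assume "l \<in> ?L"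
    then obtain p where p: "p \<in> mass_supp (empirical_law M n X)" "\<forall>a. pmf p a = real (l a) / real n"
      by (auto simp: supp_counts_def)
    then have "l = scaled_vec n p" using assms by (auto simp: scaled_vec_def)
    then show "l \<in> ?R" using p by blast
  qed
  show "?R \<subseteq> ?L"
    using assms scaled_vec_exact[OF assms] by (fastforce simp: supp_counts_def)
qed

lemma sum_empirical_law:
  fixes X :: "nat \<Rightarrow> 'w \<Rightarrow> 'a::finite"
  assumes "prob_space M" "n > 0"
    and X: "\<And>i. i \<in> {1..n} \<Longrightarrow> X i \<in> measurable M (count_space UNIV)"
  shows "(\<Sum>p\<in>mass_supp (empirical_law M n X). empirical_law M n X p) = 1"
proof -
  interpret prob_space M by fact
  define T where "T \<omega> = type_of_seq n (\<lambda>i. X i \<omega>)" for \<omega>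
  have "(\<Sum>a\<in>UNIV. type_of_seq n y a) = 1" for y :: "nat \<Rightarrow> 'a"
  proof -
    have "(\<Sum>a\<in>UNIV. type_of_seq n y a) = (1 / real n) * (\<Sum>i=1..n. \<Sum>a\<in>UNIV. of_bool (y i = a))"
      unfolding type_of_seq_def sum_distrib_left[symmetric] by (subst sum.swap) (rule refl)
    also have "\<dots> = 1" using assms(2) by (simp add: of_bool_def)
    finally show ?thesis .
  qed
  then have ex: "\<exists>p. pmf p = T \<omega>" for \<omega>
    unfolding T_def
    by (intro exI[of _ "embed_pmf (type_of_seq n (\<lambda>i. X i \<omega>))"] ext pmf_embed_pmf)
      (auto simp: type_of_seq_count nn_integral_count_space_finite sum_ennreal)
  have meas: "{\<omega> \<in> space M. T \<omega> = f} \<in> sets M" for f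
  proof -
    have [measurable]: "Measurable.pred M (\<lambda>\<omega>. X i \<omega> = a)" if "i \<in> {1..n}" for i a
      using X[OF that] by simp
    have "(\<lambda>\<omega>. T \<omega> a) \<in> borel_measurable M" for a
      unfolding T_def type_of_seq_def of_bool_def
      by (intro borel_measurable_times borel_measurable_const borel_measurable_sum measurable_If) auto
    then show ?thesis by (simp add: fun_eq_iff)
  qed
  define S where "S = mass_supp (empirical_law M n X)"
  have fS: "finite S" unfolding S_def by (rule finite_mass_supp_empirical_law)
  define K where "K = {p. pmf p \<in> T ` space M}"
  have "finite K"
  proof -
    have sub: "pmf ` K \<subseteq> {f. \<forall>a. (a \<in> UNIV \<longrightarrow> f a \<in> (\<lambda>j. real j / real n) ` {..n}) \<and> (a \<notin> UNIV \<longrightarrow> f a = 0)}"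
    proof -
      have "card {i\<in>{1..n}. X i \<omega> = a} \<le> n" for \<omega> a
      proof -
        have "card {i\<in>{1..n}. X i \<omega> = a} \<le> card {1..n}" by (rule card_mono) auto
        then show ?thesis by simp
      qed
      then show ?thesis by (auto simp: K_def T_def type_of_seq_count)
    qed
    have "finite (pmf ` K)" by (rule finite_subset[OF sub finite_set_of_finite_funs]) auto
    then show ?thesis by (rule finite_imageD) (auto intro!: inj_onI pmf_eqI)
  qed
  have "S \<subseteq> K" by (auto simp: S_def K_def T_def elim!: mass_supp_empirical_lawE)
  then have "(\<Sum>p\<in>S. empirical_law M n X p) = (\<Sum>p\<in>K. empirical_law M n X p)"
    using \<open>finite K\<close> by (intro sum.mono_neutral_left) (auto simp: S_def mass_supp_def)
  also have "\<dots> = (\<Sum>p\<in>K. prob {\<omega> \<in> space M. T \<omega> = pmf p})"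
    by (simp add: empirical_law_def T_def)
  also have "\<dots> = prob (\<Union>p\<in>K. {\<omega> \<in> space M. T \<omega> = pmf p})"
    using \<open>finite K\<close> meas
    by (intro finite_measure_finite_Union[symmetric]) (auto simp: disjoint_family_on_def pmf_eq_iff)
  also have "(\<Union>p\<in>K. {\<omega> \<in> space M. T \<omega> = pmf p}) = space M"
    using ex by (auto simp: K_def) (metis image_eqI)
  finally show ?thesis by (simp add: S_def prob_space)
qed

end

theory Submission
  imports Defs "HOL-Combinatorics.Permutations"
begin

text \<open>Given its type, an exchangeable sequence is uniform on the corresponding type class, so \<open>P\<^sub>k\<close> is
  the \<open>\<mu>\<close>-mixture of the laws of drawing \<open>k\<close> letters without replacement from an urn with counts
  \<open>n p\<close>, while \<open>M\<^bsub>k,\<mu>\<^esub>\<close> is the \<open>\<mu>\<close>-mixture of the laws of drawing with replacement. The log-sum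
  inequality (joint convexity of the relative entropy) bounds the divergence of the mixtures by the
  average divergence. Under both drawing schemes the sequence of draws is uniform given its letter
  counts, so the divergence between the sequences equals that between the counts, which are
  hypergeometric and multinomial. The maximum bounds the average.\<close>

section \<open>Log-sum inequality\<close>

text \<open>With \<open>A\<close> and \<open>B\<close> the two total masses, the bound
  \<open>ln t \<le> t - 1\<close> gives \<open>a i - b i * (A / B)\<close> as a lower bound of
  \<open>a i * ln (a i / b i) - a i * ln (A / B)\<close>, and these lower bounds sum to
  zero.\<close>

lemma log_sum_inequality:
  fixes a b :: "'i \<Rightarrow> real"
  assumes a: "\<And>i. i \<in> I \<Longrightarrow> 0 \<le> a i" and b: "\<And>i. i \<in> I \<Longrightarrow> 0 \<le> b i"
    and ac: "\<And>i. i \<in> I \<Longrightarrow> b i = 0 \<Longrightarrow> a i = 0"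
  shows "sum a I * ln (sum a I / sum b I) \<le> (\<Sum>i\<in>I. a i * ln (a i / b i))"
proof (cases "finite I \<and> sum a I \<noteq> 0")
  \<comment> \<open>Over an infinite \<open>I\<close> all sums are zero by convention; over a finite
    one, zero total mass makes every \<open>a i\<close> zero.\<close>
  case False
  then show ?thesis
  proof (cases "finite I")
    case True
    with False have "\<forall>i\<in>I. a i = 0" using a sum_nonneg_eq_0_iff by auto
    then show ?thesis by simp
  qed simp
next
  case True
  define A B where "A = sum a I" and "B = sum b I"
  have A: "A > 0" using True a by (auto simp: A_def less_le sum_nonneg)
  have B: "B > 0"
  proof -
    have "B \<noteq> 0"
    proof
      assume "B = 0"
      then have "\<forall>i\<in>I. b i = 0" using True b sum_nonneg_eq_0_iff by (auto simp: B_def)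
      then show False using True ac by simp
    qed
    then show ?thesis using b by (auto simp: B_def less_le sum_nonneg)
  qed
  have "a i - b i * (A / B) \<le> a i * ln (a i / b i) - a i * ln (A / B)" if i: "i \<in> I" for i
  proof (cases "a i = 0")
    case True
    then show ?thesis using A B b[OF i] by simp
  next
    case False
    then have pos: "a i > 0" "b i > 0" using a b ac i by (force simp: less_le)+
    \<comment> \<open>The ratio of the normalised weights \<open>b i / B\<close> and
      \<open>a i / A\<close>.\<close>
    define t where "t = b i * A / (a i * B)"
    have t: "t > 0" using pos A B by (simp add: t_def)
    have "ln (a i / b i) - ln (A / B) = - ln t"
      using pos A B by (simp add: t_def ln_div ln_mult)
    moreover have "ln t \<le> t - 1" using t by (rule ln_le_minus_one)
    ultimately have "a i * (1 - t) \<le> a i * (ln (a i / b i) - ln (A / B))"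
      using pos by (intro mult_left_mono) auto
    moreover have "a i * (1 - t) = a i - b i * (A / B)"
      using pos B by (simp add: t_def field_simps)
    ultimately show ?thesis by (simp add: right_diff_distrib)
  qed
  then have "(\<Sum>i\<in>I. a i - b i * (A / B)) \<le> (\<Sum>i\<in>I. a i * ln (a i / b i) - a i * ln (A / B))"
    by (rule sum_mono)
  moreover have "(\<Sum>i\<in>I. a i - b i * (A / B)) = 0"
    using B by (simp add: sum_subtractf sum_distrib_right[symmetric] sum_divide_distrib[symmetric] A_def[symmetric] B_def[symmetric])
  ultimately show ?thesis
    by (simp add: sum_subtractf sum_distrib_right[symmetric] A_def B_def)
qed

section \<open>Letter counts and classes of sequences with given counts\<close>

definition letter_count :: "'i set \<Rightarrow> ('i \<Rightarrow> 'a) \<Rightarrow> 'a \<Rightarrow> nat" where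
  "letter_count I x a = card {i \<in> I. x i = a}"

text \<open>The type class of information theory. Its members are \<open>undefined\<close> outside
  \<open>I\<close>, so each is determined by its values on \<open>I\<close> and counting is
  meaningful.\<close>

definition freq_class :: "'i set \<Rightarrow> ('a \<Rightarrow> nat) \<Rightarrow> ('i \<Rightarrow> 'a) set" where
  "freq_class I l = {x \<in> I \<rightarrow>\<^sub>E UNIV. letter_count I x = l}"

lemma letter_count_cong:
  "(\<And>i. i \<in> I \<Longrightarrow> x i = y i) \<Longrightarrow> letter_count I x = letter_count I y"
  unfolding letter_count_def by (intro ext arg_cong[where f = card]) auto

lemma letter_count_Un:
  assumes "finite I" "finite J" "I \<inter> J = {}"
  shows "letter_count (I \<union> J) x a = letter_count I x a + letter_count J x a"
proof -
  have "{i \<in> I \<union> J. x i = a} = {i \<in> I. x i = a} \<union> {i \<in> J. x i = a}" by auto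
  then show ?thesis unfolding letter_count_def using assms
    by (simp only:) (rule card_Un_disjoint, auto)
qed

lemma sum_letter_count:
  fixes x :: "'i \<Rightarrow> 'a::finite"
  assumes "finite I"
  shows "sum (letter_count I x) UNIV = card I"
proof -
  have "(\<Sum>a\<in>UNIV. card {i \<in> I. x i = a}) = card (\<Union>a\<in>UNIV. {i \<in> I. x i = a})"
    using assms by (intro card_UN_disjoint[symmetric]) auto
  also have "(\<Union>a\<in>UNIV. {i \<in> I. x i = a}) = I" by auto
  finally show ?thesis by (simp add: letter_count_def)
qed

lemma prod_letter_count:
  fixes f :: "'a::finite \<Rightarrow> 'b::comm_monoid_mult"
  assumes "finite I"
  shows "(\<Prod>i\<in>I. f (x i)) = (\<Prod>a\<in>UNIV. f a ^ letter_count I x a)"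
proof -
  have "(\<Prod>i\<in>I. f (x i)) = (\<Prod>a\<in>UNIV. \<Prod>i\<in>{i \<in> I. x i = a}. f (x i))"
    using assms by (intro prod.group[symmetric]) auto
  also have "\<dots> = (\<Prod>a\<in>UNIV. f a ^ letter_count I x a)"
    by (simp add: letter_count_def)
  finally show ?thesis .
qed

lemma finite_freq_class:
  "finite I \<Longrightarrow> finite (freq_class I (l :: 'a::finite \<Rightarrow> nat))"
  unfolding freq_class_def by (intro finite_subset[OF _ finite_PiE[of I "\<lambda>_. UNIV"]]) auto

lemma letter_count_insert:
  assumes "finite I" "j \<notin> I"
  shows "letter_count (insert j I) x = (letter_count I x)(x j := Suc (letter_count I x (x j)))"
proof
  fix a
  have "{i \<in> insert j I. x i = a} = (if x j = a then insert j {i \<in> I. x i = a} else {i \<in> I. x i = a})"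
    by auto
  then show "letter_count (insert j I) x a = ((letter_count I x)(x j := Suc (letter_count I x (x j)))) a"
    using assms by (auto simp: letter_count_def)
qed

text \<open>Sequences are sorted by their letter \<open>b\<close> at position \<open>j\<close>;
  dropping that position lowers the count of \<open>b\<close> by one. This is the recursion of the
  multinomial coefficients.\<close>

lemma freq_class_insert:
  assumes "finite I" "j \<notin> I"
  shows "freq_class (insert j I) l =
    (\<Union>b\<in>{b. l b > 0}. (\<lambda>x. x(j := b)) ` freq_class I (l(b := l b - 1)))"
proof (intro set_eqI iffI)
  fix x assume x: "x \<in> freq_class (insert j I) l"
  \<comment> \<open>Resetting position \<open>j\<close> makes the function extensional on
    \<open>I\<close>.\<close>
  define y where "y = x(j := undefined)"
  have y: "y \<in> I \<rightarrow>\<^sub>E UNIV" "x = y(j := x j)"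
    using x assms by (auto simp: y_def freq_class_def PiE_def extensional_def)
  have c: "letter_count I y = letter_count I x"
    by (rule letter_count_cong) (use assms in \<open>auto simp: y_def\<close>)
  have "l = (letter_count I x)(x j := Suc (letter_count I x (x j)))"
    using x letter_count_insert[OF assms, of x] by (simp add: freq_class_def)
  then have "l (x j) > 0" "letter_count I x = l(x j := l (x j) - 1)" by auto
  with y c show "x \<in> (\<Union>b\<in>{b. l b > 0}. (\<lambda>x. x(j := b)) ` freq_class I (l(b := l b - 1)))"
    unfolding freq_class_def by (intro UN_I[of "x j"] image_eqI[of _ _ y]) auto
next
  fix x assume "x \<in> (\<Union>b\<in>{b. l b > 0}. (\<lambda>x. x(j := b)) ` freq_class I (l(b := l b - 1)))"
  then obtain b y where b: "l b > 0" and x: "x = y(j := b)"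
    and y: "y \<in> I \<rightarrow>\<^sub>E UNIV" "letter_count I y = l(b := l b - 1)"
    by (auto simp: freq_class_def)
  have "letter_count I x = letter_count I y"
    by (rule letter_count_cong) (use assms x in auto)
  then have "letter_count (insert j I) x = l"
    using b y x by (simp add: letter_count_insert[OF assms])
  moreover have "x \<in> insert j I \<rightarrow>\<^sub>E UNIV" using x y by (auto simp: PiE_def extensional_def)
  ultimately show "x \<in> freq_class (insert j I) l" by (simp add: freq_class_def)
qed

text \<open>The size is a multinomial coefficient, multiplied out to stay within the natural
  numbers. When a position is added, the sequences with letter \<open>b\<close> there contribute
  \<open>l b * fact (card I)\<close>, and the \<open>l b\<close> add up to the new number of
  positions.\<close>

lemma card_freq_class:
  fixes l :: "'a::finite \<Rightarrow> nat" and I :: "'i set"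
  assumes "finite I" "sum l UNIV = card I"
  shows "card (freq_class I l) * (\<Prod>a\<in>UNIV. fact (l a)) = fact (card I)"
  using assms
proof (induction I arbitrary: l rule: finite_induct)
  case empty
  then have "l = (\<lambda>_. 0)" by auto
  then have "freq_class ({} :: 'i set) l = {\<lambda>_. undefined}" by (auto simp: freq_class_def letter_count_def)
  then show ?case using \<open>l = (\<lambda>_. 0)\<close> by simp
next
  case (insert j I)
  let ?l = "\<lambda>b. l(b := l b - 1)"
  \<comment> \<open>Both functions are \<open>undefined\<close> at \<open>j\<close>, so overwriting
    that value loses no information.\<close>
  have inj: "inj_on (\<lambda>x. x(j := b)) (freq_class I (?l b))" for b
  proof (rule inj_onI)
    fix x y assume xy: "x \<in> freq_class I (?l b)" "y \<in> freq_class I (?l b)" "x(j := b) = y(j := b)"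
    have "x i = y i" for i
      using xy(1,2) fun_cong[OF xy(3), of i] insert.hyps(2)
      by (cases "i = j") (auto simp: freq_class_def PiE_def extensional_def)
    then show "x = y" by auto
  qed
  have "card (freq_class (insert j I) l) =
      (\<Sum>b\<in>{b. l b > 0}. card ((\<lambda>x. x(j := b)) ` freq_class I (?l b)))"
    unfolding freq_class_insert[OF insert.hyps(1,2)]
    by (intro card_UN_disjoint) (auto simp: finite_freq_class insert.hyps fun_upd_eqD dest: fun_upd_eqD)
  also have "\<dots> = (\<Sum>b\<in>{b. l b > 0}. card (freq_class I (?l b)))"
    by (intro sum.cong refl card_image inj)
  finally have "card (freq_class (insert j I) l) * (\<Prod>a\<in>UNIV. fact (l a)) =
      (\<Sum>b\<in>{b. l b > 0}. card (freq_class I (?l b)) * (\<Prod>a\<in>UNIV. fact (l a)))"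
    by (simp add: sum_distrib_right)
  also have "\<dots> = (\<Sum>b\<in>{b. l b > 0}. l b * fact (card I))"
  proof (rule sum.cong[OF refl])
    fix b assume "b \<in> {b. l b > 0}"
    then have b: "l b > 0" by simp
    have rem: "(\<Prod>a\<in>UNIV-{b}. fact (?l b a)) = (\<Prod>a\<in>UNIV-{b}. fact (l a) :: nat)"
      by (intro prod.cong) auto
    have "(\<Prod>a\<in>UNIV. fact (l a)) = l b * (\<Prod>a\<in>UNIV. fact (?l b a) :: nat)"
    proof -
      have "(\<Prod>a\<in>UNIV. fact (l a)) = fact (l b) * (\<Prod>a\<in>UNIV-{b}. fact (l a) :: nat)"
        by (rule prod.remove) auto
      moreover have "(\<Prod>a\<in>UNIV. fact (?l b a)) = fact (l b - 1) * (\<Prod>a\<in>UNIV-{b}. fact (l a) :: nat)"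
        by (subst prod.remove[of UNIV b]) (simp_all only: rem fun_upd_same finite UNIV_I)
      ultimately show ?thesis using b by (simp only: fact_reduce[of "l b"] of_nat_id mult.assoc)
    qed
    moreover have "sum (?l b) UNIV = card I"
    proof -
      have "sum (?l b) (UNIV - {b}) = sum l (UNIV - {b})" by (intro sum.cong) auto
      moreover have "sum l UNIV = l b + sum l (UNIV - {b})"
        "sum (?l b) UNIV = ?l b b + sum (?l b) (UNIV - {b})"
        by (rule sum.remove; simp)+
      ultimately show ?thesis using b insert.prems insert.hyps by simp
    qed
    ultimately show "card (freq_class I (?l b)) * (\<Prod>a\<in>UNIV. fact (l a)) = l b * fact (card I)"
      using insert.IH[of "?l b"] by (simp del: fun_upd_apply add: mult.left_commute)
  qed
  \<comment> \<open>Letters with \<open>l b = 0\<close> contribute nothing, so the sum may run over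
    the whole alphabet.\<close>
  also have "\<dots> = (\<Sum>b\<in>UNIV. l b) * fact (card I)"
    unfolding sum_distrib_right by (intro sum.mono_neutral_left) auto
  also have "\<dots> = fact (card (insert j I))" using insert by simp
  finally show ?case .
qed

lemma card_freq_class_real:
  fixes l :: "'a::finite \<Rightarrow> nat"
  assumes "finite I" "sum l UNIV = card I"
  shows "real (card (freq_class I l)) = fact (card I) / (\<Prod>a\<in>UNIV. fact (l a))"
proof -
  have "real (card (freq_class I l) * (\<Prod>a\<in>UNIV. fact (l a))) = real (fact (card I))"
    using card_freq_class[OF assms] by simp
  then show ?thesis by (simp add: field_simps)
qed

text \<open>Once the entries on \<open>I\<close> are fixed, those on \<open>J\<close> range over all
  sequences with the remaining counts: restriction to \<open>J\<close> and pasting \<open>z\<close>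
  back on \<open>I\<close> are mutually inverse. The bound by \<open>l\<close> keeps the truncated
  subtraction exact.\<close>

lemma freq_class_extensions:
  fixes z :: "'i \<Rightarrow> 'a"
  assumes "finite I" "finite J" "I \<inter> J = {}" "letter_count I z \<le> l"
  shows "card {x \<in> freq_class (I \<union> J) l. \<forall>i\<in>I. x i = z i} =
    card (freq_class J (\<lambda>a. l a - letter_count I z a))"
proof (rule bij_betw_same_card[of "\<lambda>x. restrict x J"],
    rule bij_betw_byWitness[where f' = "\<lambda>y i. if i \<in> I then z i else y i"])
  have spl: "letter_count (I \<union> J) x a = letter_count I z a + letter_count J x a"
    if "\<forall>i\<in>I. x i = z i" for x a
    using letter_count_Un[OF assms(1-3), of x a] letter_count_cong[of I x z] that by auto
  show "\<forall>x\<in>{x \<in> freq_class (I \<union> J) l. \<forall>i\<in>I. x i = z i}.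
      (\<lambda>i. if i \<in> I then z i else restrict x J i) = x"
    by (fastforce simp: freq_class_def PiE_def extensional_def)
  show "\<forall>y\<in>freq_class J (\<lambda>a. l a - letter_count I z a).
      restrict (\<lambda>i. if i \<in> I then z i else y i) J = y"
    using assms(3) by (fastforce simp: freq_class_def PiE_def extensional_def)
  show "(\<lambda>x. restrict x J) ` {x \<in> freq_class (I \<union> J) l. \<forall>i\<in>I. x i = z i}
      \<subseteq> freq_class J (\<lambda>a. l a - letter_count I z a)"
  proof safe
    fix x assume x: "x \<in> freq_class (I \<union> J) l" "\<forall>i\<in>I. x i = z i"
    have "letter_count J (restrict x J) = letter_count J x" by (rule letter_count_cong) simp
    moreover have "letter_count J x a = l a - letter_count I z a" for a
      using spl[OF x(2), of a] x(1) by (auto simp: freq_class_def)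
    ultimately show "restrict x J \<in> freq_class J (\<lambda>a. l a - letter_count I z a)"
      by (simp add: freq_class_def fun_eq_iff)
  qed
  show "(\<lambda>y i. if i \<in> I then z i else y i) ` freq_class J (\<lambda>a. l a - letter_count I z a)
      \<subseteq> {x \<in> freq_class (I \<union> J) l. \<forall>i\<in>I. x i = z i}"
  proof
    fix x assume "x \<in> (\<lambda>y i. if i \<in> I then z i else y i) ` freq_class J (\<lambda>a. l a - letter_count I z a)"
    then obtain y where y: "y \<in> J \<rightarrow>\<^sub>E UNIV" "letter_count J y = (\<lambda>a. l a - letter_count I z a)"
      and x: "x = (\<lambda>i. if i \<in> I then z i else y i)" by (auto simp: freq_class_def)
    have "letter_count J x = letter_count J y"
      by (rule letter_count_cong) (use assms(3) x in auto)
    then have "letter_count (I \<union> J) x a = l a" for a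
      using spl[of x a] y(2) assms(4) by (simp add: x le_fun_def)
    then show "x \<in> {x \<in> freq_class (I \<union> J) l. \<forall>i\<in>I. x i = z i}"
      using y(1) by (auto simp: freq_class_def x PiE_def extensional_def)
  qed
qed

text \<open>Equal letter counts mean equal multisets of values, and finite families with equal
  multisets are rearrangements of each other.\<close>

lemma freq_class_permutes:
  fixes x y :: "'i \<Rightarrow> 'a"
  assumes "finite I" "x \<in> freq_class I l" "y \<in> freq_class I l"
  obtains \<pi> where "\<pi> permutes I" "\<forall>i\<in>I. x i = y (\<pi> i)"
proof -
  have "image_mset x (mset_set I) = image_mset y (mset_set I)"
  proof (rule multiset_eqI)
    fix a :: 'a
    have "count (image_mset f (mset_set I)) a = letter_count I f a" for f :: "'i \<Rightarrow> 'a"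
      using assms(1) by (simp add: count_image_mset letter_count_def vimage_def Int_def conj_commute)
    then show "count (image_mset x (mset_set I)) a = count (image_mset y (mset_set I)) a"
      using assms by (auto simp: freq_class_def)
  qed
  then show thesis
    using image_mset_eq_implies_permutes[OF assms(1), of x y] that by blast
qed

section \<open>Draws without and with replacement: sequences versus counts\<close>

text \<open>The conditional probability that \<open>X\<^sub>1, \<dots>, X\<^sub>k\<close> equals \<open>z\<close>, given that \<open>X\<^sub>1, \<dots>, X\<^sub>n\<close> has
  letter counts \<open>l\<close>.\<close>

definition without_replacement :: "nat \<Rightarrow> nat \<Rightarrow> ('a::finite \<Rightarrow> nat) \<Rightarrow> (nat \<Rightarrow> 'a) \<Rightarrow> real" where
  "without_replacement n k l z =
    real (card {x \<in> freq_class {1..n} l. \<forall>i\<in>{1..k}. x i = z i}) / real (card (freq_class {1..n} l))"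

text \<open>An urn cannot yield more copies of a letter than it holds.\<close>

lemma without_replacement_eq_0:
  assumes "\<not> letter_count {1..k} z \<le> l" "k \<le> n"
  shows "without_replacement n k l z = 0"
proof -
  have "letter_count {1..k} z \<le> l" if "x \<in> freq_class {1..n} l" "\<forall>i\<in>{1..k}. x i = z i" for x
  proof -
    have "letter_count {1..k} z = letter_count {1..k} x"
      using that by (intro letter_count_cong) auto
    also have "\<dots> \<le> letter_count {1..n} x"
      unfolding letter_count_def le_fun_def using assms(2) by (auto intro!: card_mono)
    finally show ?thesis using that by (simp add: freq_class_def)
  qed
  then have "{x \<in> freq_class {1..n} l. \<forall>i\<in>{1..k}. x i = z i} = {}" using assms(1) by blast
  then show ?thesis by (simp only: without_replacement_def) simp
qed

text \<open>All orderings of the same counts are equally likely, so the mass of the counts is the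
  number of orderings times the probability of one. That probability is the number of completions of
  \<open>z\<close> over the size of the class, a quotient of two multinomial coefficients.\<close>

lemma hypergeom_letter_count:
  fixes l :: "'a::finite \<Rightarrow> nat" and z :: "nat \<Rightarrow> 'a"
  assumes "sum l UNIV = n" "k \<le> n"
  defines "s \<equiv> letter_count {1..k} z"
  shows "hypergeom n k l s = real (card (freq_class {1..k} s)) * without_replacement n k l z"
proof (cases "s \<le> l")
  case False
  then show ?thesis
    using without_replacement_eq_0[of k z l n] assms by (auto simp: hypergeom_def le_fun_def)
next
  case True
  have s: "sum s UNIV = k" by (simp add: s_def sum_letter_count)
  have un: "{1..k} \<union> {Suc k..n} = {1..n}" using assms(2) by auto
  have "card {x \<in> freq_class {1..n} l. \<forall>i\<in>{1..k}. x i = z i} =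
      card (freq_class {Suc k..n} (\<lambda>a. l a - s a))"
    using freq_class_extensions[of "{1..k}" "{Suc k..n}" z l] True unfolding un s_def by simp
  moreover have "(\<Sum>a\<in>UNIV. l a - s a) = card {Suc k..n}"
    using True assms(1) s by (simp add: sum_subtractf_nat le_fun_def)
  ultimately have "without_replacement n k l z =
      (fact (n - k) / (\<Prod>a\<in>UNIV. fact (l a - s a))) / (fact n / (\<Prod>a\<in>UNIV. fact (l a)))"
    using assms(1) by (simp add: without_replacement_def card_freq_class_real)
  moreover have "hypergeom n k l s =
      (\<Prod>a\<in>UNIV. fact (l a) / (fact (s a) * fact (l a - s a))) / (fact n / (fact k * fact (n - k)))"
    using True s assms(2) by (simp add: hypergeom_def le_fun_def binomial_fact)
  ultimately show ?thesis
    using s by (simp add: card_freq_class_real prod_dividef prod.distrib mult_ac)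
qed

text \<open>The number of orderings is the same factor as in \<open>hypergeom_letter_count\<close>,
  so it cancels in the likelihood ratio.\<close>

lemma multinom_letter_count:
  fixes l :: "'a::finite \<Rightarrow> nat" and z :: "nat \<Rightarrow> 'a" and k :: nat
  defines "s \<equiv> letter_count {1..k} z"
  shows "multinom n k l s = real (card (freq_class {1..k} s)) * (\<Prod>j=1..k. real (l (z j)) / real n)"
proof -
  have "sum s UNIV = k" by (simp add: s_def sum_letter_count)
  then show ?thesis
    using prod_letter_count[of "{1..k}" "\<lambda>a. real (l a) / real n" z]
    by (simp add: multinom_def card_freq_class_real s_def)
qed

lemma multinom_eq_0_iff:
  assumes "n > 0"
  shows "multinom n k l s = 0 \<longleftrightarrow> sum s UNIV \<noteq> k \<or> (\<exists>a. l a = 0 \<and> s a \<noteq> 0)"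
  using assms by (auto simp: multinom_def)

text \<open>On a class of sequences with equal counts both probabilities are constant, and their
  ratio is that of the masses of the counts. Grouping the sequences by counts therefore turns one
  divergence into the other.\<close>

lemma D_hyp_mult_sequences:
  fixes l :: "'a::finite \<Rightarrow> nat"
  assumes l: "sum l UNIV = n" and "k \<le> n" "n > 0"
  shows "D_hyp_mult n k l = ereal (\<Sum>z\<in>{1..k} \<rightarrow>\<^sub>E UNIV. without_replacement n k l z *
    ln (without_replacement n k l z / (\<Prod>j=1..k. real (l (z j)) / real n)))"
proof -
  let ?S = "{s :: 'a \<Rightarrow> nat. sum s UNIV = k}"
  let ?Z = "{1..k} \<rightarrow>\<^sub>E (UNIV :: 'a set)"
  define g where "g z = without_replacement n k l z *
    ln (without_replacement n k l z / (\<Prod>j=1..k. real (l (z j)) / real n))" for z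
  \<comment> \<open>Nonzero hypergeometric mass forces \<open>s a \<le> l a\<close>, so no letter
    with \<open>l a = 0\<close> is used. Hence \<open>rel_entropy\<close> takes its finite
    branch.\<close>
  have "multinom n k l s \<noteq> 0" if "hypergeom n k l s \<noteq> 0" for s
  proof -
    have "\<forall>a. s a \<le> l a" "sum s UNIV = k"
      using that unfolding hypergeom_def by meson+
    then show ?thesis
      using \<open>n > 0\<close> by (metis le_zero_eq multinom_eq_0_iff)
  qed
  then have "\<not> (\<exists>s\<in>?S. hypergeom n k l s \<noteq> 0 \<and> multinom n k l s = 0)" by blast
  then have "D_hyp_mult n k l =
      ereal (\<Sum>s\<in>?S. hypergeom n k l s * ln (hypergeom n k l s / multinom n k l s))"
    by (simp add: D_hyp_mult_def rel_entropy_def)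
  also have "(\<Sum>s\<in>?S. hypergeom n k l s * ln (hypergeom n k l s / multinom n k l s)) =
      (\<Sum>s\<in>?S. \<Sum>z\<in>{z \<in> ?Z. letter_count {1..k} z = s}. g z)"
  proof (rule sum.cong[OF refl])
    fix s :: "'a \<Rightarrow> nat" assume "s \<in> ?S"
    then have s: "sum s UNIV = card {1..k}" by simp
    \<comment> \<open>A factor of a factorial is nonzero, so the class is nonempty and its size may
      be divided by.\<close>
    have "card (freq_class {1..k} s) * (\<Prod>a\<in>UNIV. fact (s a)) = fact k"
      using card_freq_class[OF _ s] by simp
    then have pos: "card (freq_class {1..k} s) \<noteq> 0" by (metis fact_nonzero mult_eq_0_iff)
    have "g z = hypergeom n k l s * ln (hypergeom n k l s / multinom n k l s) /
        real (card (freq_class {1..k} s))" if "z \<in> freq_class {1..k} s" for z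
    proof -
      have "letter_count {1..k} z = s" using that by (simp add: freq_class_def)
      then show ?thesis
        using hypergeom_letter_count[OF assms(1,2), of z] multinom_letter_count[of n k l z] pos
        by (simp add: g_def)
    qed
    then have "(\<Sum>z\<in>freq_class {1..k} s. g z) =
        hypergeom n k l s * ln (hypergeom n k l s / multinom n k l s)"
      using pos by simp
    then show "hypergeom n k l s * ln (hypergeom n k l s / multinom n k l s) =
        (\<Sum>z\<in>{z \<in> ?Z. letter_count {1..k} z = s}. g z)"
      by (simp add: freq_class_def)
  qed
  also have "\<dots> = sum g ?Z"
  proof (rule sum.group)
    show "finite ?Z" by (simp add: finite_PiE)
    have "?S \<subseteq> {s. \<forall>a. (a \<in> UNIV \<longrightarrow> s a \<in> {..k}) \<and> (a \<notin> UNIV \<longrightarrow> s a = 0)}"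
      by (auto intro: member_le_sum)
    then show "finite ?S" by (rule finite_subset) (rule finite_set_of_finite_funs; simp)
    show "letter_count {1..k} ` ?Z \<subseteq> ?S" by (auto simp: sum_letter_count)
  qed
  finally show ?thesis by (simp add: g_def)
qed

section \<open>Empirical law and exchangeability in terms of counts\<close>

lemma sum_scaled_vec_empirical_law:
  fixes X :: "nat \<Rightarrow> 'w \<Rightarrow> 'a::finite"
  assumes "n > 0" "p \<in> mass_supp (empirical_law M n X)"
  shows "sum (scaled_vec n p) UNIV = n"
proof -
  have "real (sum (scaled_vec n p) UNIV) = real n * sum (pmf p) UNIV"
    by (simp add: scaled_vec_exact[OF assms] sum_distrib_left)
  also have "sum (pmf p) UNIV = 1" by (rule sum_pmf_eq_1) auto
  finally show ?thesis by (simp only: mult_1_right of_nat_eq_iff)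
qed

lemma type_of_seq_eq_pmf_iff:
  fixes X :: "nat \<Rightarrow> 'w \<Rightarrow> 'a::finite"
  assumes "n > 0" "p \<in> mass_supp (empirical_law M n X)"
  shows "type_of_seq n y = pmf p \<longleftrightarrow> letter_count {1..n} y = scaled_vec n p"
proof -
  have "type_of_seq n y a = pmf p a \<longleftrightarrow> letter_count {1..n} y a = scaled_vec n p a" for a
  proof -
    have "pmf p a = real (scaled_vec n p a) / real n"
      using assms by (simp add: scaled_vec_exact)
    then show ?thesis using assms(1) by (simp add: type_of_seq_count letter_count_def)
  qed
  then show ?thesis by (simp add: fun_eq_iff)
qed

text \<open>\<open>scaled_vec n\<close> is exact, hence injective, on the support, and a sequence
  has only one vector of counts.\<close>

lemma disjoint_freq_classes:
  fixes X :: "nat \<Rightarrow> 'w \<Rightarrow> 'a::finite"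
  assumes "n > 0" and pq: "p \<in> mass_supp (empirical_law M n X)" "q \<in> mass_supp (empirical_law M n X)"
    and "p \<noteq> q"
  shows "freq_class {1..n} (scaled_vec n p) \<inter> freq_class {1..n} (scaled_vec n q) = {}"
proof (rule ccontr)
  assume "\<not> ?thesis"
  then have "scaled_vec n p = scaled_vec n q" by (auto simp: freq_class_def)
  then have "pmf p a = pmf q a" for a
    using scaled_vec_exact[OF assms(1) pq(1), of a] scaled_vec_exact[OF assms(1) pq(2), of a] assms(1)
    by simp
  then show False using \<open>p \<noteq> q\<close> pmf_eqI by blast
qed

text \<open>The event is a finite disjoint union of events that fix all \<open>n\<close>
  coordinates.\<close>

lemma prob_eq_sum_joint_pmf:
  fixes X :: "nat \<Rightarrow> 'w \<Rightarrow> 'a::finite"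
  assumes "prob_space M"
    and X: "\<forall>i\<in>{1..n}. X i \<in> measurable M (count_space UNIV)"
    and A: "A \<subseteq> {1..n} \<rightarrow>\<^sub>E UNIV"
  shows "measure M {\<omega> \<in> space M. (\<lambda>i\<in>{1..n}. X i \<omega>) \<in> A} = (\<Sum>x\<in>A. joint_pmf M X n x)"
proof -
  interpret prob_space M by fact
  have fin: "finite A" by (rule finite_subset[OF A]) (simp add: finite_PiE)
  have [measurable]: "Measurable.pred M (\<lambda>\<omega>. X i \<omega> = a)" if "i \<in> {1..n}" for i a
  proof -
    have "X i \<in> measurable M (count_space UNIV)" using X that by blast
    then show ?thesis by simp
  qed
  have "{\<omega> \<in> space M. (\<lambda>i\<in>{1..n}. X i \<omega>) \<in> A} =
      (\<Union>x\<in>A. {\<omega> \<in> space M. \<forall>i\<in>{1..n}. X i \<omega> = x i})"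
  proof -
    \<comment> \<open>Members of \<open>A\<close> are extensional, so agreement on
      \<open>{1..n}\<close> with a restricted function is equality.\<close>
    have eq: "(\<lambda>i\<in>{1..n}. X i \<omega>) = x \<longleftrightarrow> (\<forall>i\<in>{1..n}. X i \<omega> = x i)" if "x \<in> A" for x \<omega>
      using that A by (fastforce simp: fun_eq_iff PiE_def extensional_def restrict_def)
    have "(\<lambda>i\<in>{1..n}. X i \<omega>) \<in> A \<longleftrightarrow> (\<exists>x\<in>A. (\<lambda>i\<in>{1..n}. X i \<omega>) = x)" for \<omega> by blast
    then have "(\<lambda>i\<in>{1..n}. X i \<omega>) \<in> A \<longleftrightarrow> (\<exists>x\<in>A. \<forall>i\<in>{1..n}. X i \<omega> = x i)" for \<omega>
      by (simp only: eq cong: bex_cong)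
    then show ?thesis by blast
  qed
  also have "prob \<dots> = (\<Sum>x\<in>A. prob {\<omega> \<in> space M. \<forall>i\<in>{1..n}. X i \<omega> = x i})"
  proof (rule finite_measure_finite_Union[OF fin])
    show "(\<lambda>x. {\<omega> \<in> space M. \<forall>i\<in>{1..n}. X i \<omega> = x i}) ` A \<subseteq> events"
      by (intro image_subsetI sets.sets_Collect_finite_All) auto
    show "disjoint_family_on (\<lambda>x. {\<omega> \<in> space M. \<forall>i\<in>{1..n}. X i \<omega> = x i}) A"
    proof (unfold disjoint_family_on_def, intro ballI impI)
      fix x y assume xy: "x \<in> A" "y \<in> A" "x \<noteq> y"
      then have "\<exists>i\<in>{1..n}. x i \<noteq> y i" using A PiE_ext[of x "{1..n}" "\<lambda>_. UNIV" y] by blast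
      then show "{\<omega> \<in> space M. \<forall>i\<in>{1..n}. X i \<omega> = x i} \<inter>
          {\<omega> \<in> space M. \<forall>i\<in>{1..n}. X i \<omega> = y i} = {}" by auto
    qed
  qed
  finally show ?thesis by (simp add: joint_pmf_def)
qed

text \<open>Exchangeability replaces the event \<open>X i = x (\<pi> i)\<close> for all
  \<open>i\<close> by \<open>X (\<pi> i) = x (\<pi> i)\<close> for all \<open>i\<close>, which is
  \<open>X i = x i\<close> for all \<open>i\<close> after reindexing by the bijection
  \<open>\<pi>\<close>.\<close>

lemma joint_pmf_permute:
  fixes X :: "nat \<Rightarrow> 'w \<Rightarrow> 'a::finite"
  assumes X: "\<forall>i\<in>{1..n}. X i \<in> measurable M (count_space UNIV)"
    and ex: "exchangeable M n X" and \<pi>: "\<pi> permutes {1..n}"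
  shows "joint_pmf M X n (\<lambda>i. x (\<pi> i)) = joint_pmf M X n x"
proof -
  let ?N = "PiM {1..n} (\<lambda>_. count_space (UNIV :: 'a set))"
  let ?A = "PiE {1..n} (\<lambda>i. {x (\<pi> i)})"
  have A: "?A \<in> sets ?N" by (rule sets_PiM_I_finite) auto
  \<comment> \<open>Applied below both to \<open>\<pi>\<close> and to the identity.\<close>
  have law: "measure (distr M ?N (\<lambda>\<omega>. \<lambda>i\<in>{1..n}. X (\<rho> i) \<omega>)) ?A =
      measure M {\<omega> \<in> space M. \<forall>i\<in>{1..n}. X (\<rho> i) \<omega> = x (\<pi> i)}" if "\<rho> permutes {1..n}" for \<rho>
  proof -
    have "(\<lambda>\<omega>. \<lambda>i\<in>{1..n}. X (\<rho> i) \<omega>) \<in> measurable M ?N"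
      using X permutes_in_image[OF that] by (intro measurable_restrict) blast
    then show ?thesis
      by (subst measure_distr[OF _ A])
        (auto intro!: arg_cong[where f = "measure M"] simp: PiE_iff)
  qed
  have "measure M {\<omega> \<in> space M. \<forall>i\<in>{1..n}. X (\<pi> i) \<omega> = x (\<pi> i)} =
      measure M {\<omega> \<in> space M. \<forall>i\<in>{1..n}. X i \<omega> = x (\<pi> i)}"
    using law[OF \<pi>] law[OF permutes_id] ex \<pi> by (simp add: exchangeable_def)
  moreover have "(\<forall>i\<in>{1..n}. X (\<pi> i) \<omega> = x (\<pi> i)) \<longleftrightarrow> (\<forall>i\<in>{1..n}. X i \<omega> = x i)" for \<omega>
    using permutes_image[OF \<pi>] by (metis (no_types, lifting) image_iff)
  ultimately show ?thesis by (simp add: joint_pmf_def)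
qed

lemma joint_pmf_freq_class:
  fixes X :: "nat \<Rightarrow> 'w \<Rightarrow> 'a::finite"
  assumes X: "\<forall>i\<in>{1..n}. X i \<in> measurable M (count_space UNIV)"
    and ex: "exchangeable M n X"
    and xy: "x \<in> freq_class {1..n} l" "y \<in> freq_class {1..n} l"
  shows "joint_pmf M X n x = joint_pmf M X n y"
proof -
  obtain \<pi> where \<pi>: "\<pi> permutes {1..n}" "\<forall>i\<in>{1..n}. x i = y (\<pi> i)"
    using freq_class_permutes[OF _ xy] by blast
  have "joint_pmf M X n x = joint_pmf M X n (\<lambda>i. y (\<pi> i))" using \<pi>(2) by (simp add: joint_pmf_def)
  then show ?thesis using joint_pmf_permute[OF X ex \<pi>(1)] by simp
qed

text \<open>By exchangeability the joint p.m.f. is constant on a class, so a subset carries mass in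
  proportion to its size.\<close>

lemma sum_joint_pmf_freq_class:
  fixes X :: "nat \<Rightarrow> 'w \<Rightarrow> 'a::finite"
  assumes X: "\<forall>i\<in>{1..n}. X i \<in> measurable M (count_space UNIV)"
    and ex: "exchangeable M n X" and B: "B \<subseteq> freq_class {1..n} l"
  shows "(\<Sum>x\<in>B. joint_pmf M X n x) =
    (\<Sum>x\<in>freq_class {1..n} l. joint_pmf M X n x) * (real (card B) / real (card (freq_class {1..n} l)))"
proof (cases "freq_class {1..n} l = {}")
  case True
  then show ?thesis using B by simp
next
  case False
  then obtain y where y: "y \<in> freq_class {1..n} l" by auto
  have J: "joint_pmf M X n x = joint_pmf M X n y" if "x \<in> freq_class {1..n} l" for x
    using joint_pmf_freq_class[OF X ex that y] by simp
  have "(\<Sum>x\<in>B. joint_pmf M X n x) = (\<Sum>x\<in>B. joint_pmf M X n y)"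
    using B J by (intro sum.cong) auto
  moreover have "(\<Sum>x\<in>freq_class {1..n} l. joint_pmf M X n x) =
      (\<Sum>x\<in>freq_class {1..n} l. joint_pmf M X n y)"
    using J by (intro sum.cong) auto
  moreover have "card (freq_class {1..n} l) \<noteq> 0" using False by (simp add: finite_freq_class)
  ultimately show ?thesis by simp
qed

lemma empirical_law_eq_sum:
  fixes X :: "nat \<Rightarrow> 'w \<Rightarrow> 'a::finite"
  assumes "prob_space M" "n > 0"
    and X: "\<forall>i\<in>{1..n}. X i \<in> measurable M (count_space UNIV)"
    and p: "p \<in> mass_supp (empirical_law M n X)"
  shows "empirical_law M n X p = (\<Sum>x\<in>freq_class {1..n} (scaled_vec n p). joint_pmf M X n x)"
proof -
  have "letter_count {1..n} (\<lambda>i\<in>{1..n}. X i \<omega>) = letter_count {1..n} (\<lambda>i. X i \<omega>)" for \<omega>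
    by (rule letter_count_cong) simp
  then have "(\<lambda>i\<in>{1..n}. X i \<omega>) \<in> freq_class {1..n} (scaled_vec n p) \<longleftrightarrow>
      type_of_seq n (\<lambda>i. X i \<omega>) = pmf p" for \<omega>
    using type_of_seq_eq_pmf_iff[OF \<open>n > 0\<close> p] by (simp add: freq_class_def)
  moreover have "freq_class {1..n} (scaled_vec n p) \<subseteq> {1..n} \<rightarrow>\<^sub>E UNIV" by (auto simp: freq_class_def)
  ultimately show ?thesis
    using prob_eq_sum_joint_pmf[OF assms(1) X, of "freq_class {1..n} (scaled_vec n p)"]
    by (simp only: empirical_law_def)
qed

text \<open>The classes coming from the support already carry total mass one, which leaves no mass
  for a sequence outside them.\<close>

lemma freq_class_of_joint_pmf:
  fixes X :: "nat \<Rightarrow> 'w \<Rightarrow> 'a::finite"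
  assumes "prob_space M" "n > 0"
    and X: "\<forall>i\<in>{1..n}. X i \<in> measurable M (count_space UNIV)"
    and x: "x \<in> {1..n} \<rightarrow>\<^sub>E UNIV" "joint_pmf M X n x \<noteq> 0"
  shows "\<exists>p\<in>mass_supp (empirical_law M n X). x \<in> freq_class {1..n} (scaled_vec n p)"
proof (rule ccontr)
  assume no: "\<not> ?thesis"
  let ?S = "mass_supp (empirical_law M n X)"
  let ?F = "\<lambda>p. freq_class {1..n} (scaled_vec n p)"
  let ?U = "\<Union>p\<in>?S. ?F p"
  have sub: "?U \<subseteq> {1..n} \<rightarrow>\<^sub>E UNIV" by (auto simp: freq_class_def)
  have finS: "finite ?S" by (rule finite_mass_supp_empirical_law)
  have finU: "finite ?U" using finS by (simp add: finite_freq_class)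
  have "(\<Sum>x\<in>?U. joint_pmf M X n x) = (\<Sum>p\<in>?S. \<Sum>x\<in>?F p. joint_pmf M X n x)"
    using finS disjoint_freq_classes[OF assms(2), of _ M X]
    by (intro sum.UNION_disjoint) (auto simp: finite_freq_class)
  also have "\<dots> = (\<Sum>p\<in>?S. empirical_law M n X p)"
    by (rule sum.cong[OF refl]) (rule empirical_law_eq_sum[OF assms(1,2) X, symmetric])
  also have "\<dots> = 1" using X by (intro sum_empirical_law[OF assms(1,2)]) auto
  finally have U: "(\<Sum>x\<in>?U. joint_pmf M X n x) = 1" .
  have "(\<Sum>y\<in>insert x ?U. joint_pmf M X n y) =
      measure M {\<omega> \<in> space M. (\<lambda>i\<in>{1..n}. X i \<omega>) \<in> insert x ?U}"
    using prob_eq_sum_joint_pmf[OF assms(1) X, of "insert x ?U"] sub x(1) by simp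
  also have "\<dots> \<le> 1" by (rule prob_space.prob_le_1[OF assms(1)])
  finally have "joint_pmf M X n x \<le> 0" using no finU U by simp
  then show False using x(2) by (simp add: joint_pmf_def order_antisym)
qed

text \<open>The event that the first \<open>k\<close> letters are \<open>z\<close> is split into
  full sequences of length \<open>n\<close>, and these are sorted by class. Uniformity within a
  class yields the factor \<open>without_replacement\<close>.\<close>

lemma joint_pmf_eq_mixture:
  fixes X :: "nat \<Rightarrow> 'w \<Rightarrow> 'a::finite"
  assumes "prob_space M" "n > 0" "k \<le> n"
    and X: "\<forall>i\<in>{1..n}. X i \<in> measurable M (count_space UNIV)"
    and ex: "exchangeable M n X"
  shows "joint_pmf M X k z = (\<Sum>p\<in>mass_supp (empirical_law M n X).
    empirical_law M n X p * without_replacement n k (scaled_vec n p) z)"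
proof -
  let ?S = "mass_supp (empirical_law M n X)"
  let ?F = "\<lambda>p. freq_class {1..n} (scaled_vec n p)"
  let ?E = "{x \<in> {1..n} \<rightarrow>\<^sub>E UNIV. \<forall>i\<in>{1..k}. x i = z i}"
  let ?G = "\<lambda>p. {x \<in> ?F p. \<forall>i\<in>{1..k}. x i = z i}"
  have finS: "finite ?S" by (rule finite_mass_supp_empirical_law)
  have "joint_pmf M X k z = measure M {\<omega> \<in> space M. (\<lambda>i\<in>{1..n}. X i \<omega>) \<in> ?E}"
    unfolding joint_pmf_def using \<open>k \<le> n\<close> by (intro arg_cong[where f = "measure M"]) auto
  also have "\<dots> = (\<Sum>x\<in>?E. joint_pmf M X n x)"
    by (rule prob_eq_sum_joint_pmf[OF assms(1) X]) auto
  also have "\<dots> = (\<Sum>x\<in>(\<Union>p\<in>?S. ?G p). joint_pmf M X n x)"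
  proof (rule sum.mono_neutral_right)
    show "finite ?E" by (rule finite_subset[of _ "{1..n} \<rightarrow>\<^sub>E UNIV"]) (auto simp: finite_PiE)
    show "(\<Union>p\<in>?S. ?G p) \<subseteq> ?E" by (auto simp: freq_class_def)
    show "\<forall>x\<in>?E - (\<Union>p\<in>?S. ?G p). joint_pmf M X n x = 0"
      using freq_class_of_joint_pmf[OF assms(1,2) X] by blast
  qed
  also have "\<dots> = (\<Sum>p\<in>?S. \<Sum>x\<in>?G p. joint_pmf M X n x)"
    using finS disjoint_freq_classes[OF assms(2), of _ M X]
    by (intro sum.UNION_disjoint) (auto simp: finite_freq_class)
  also have "\<dots> = (\<Sum>p\<in>?S. empirical_law M n X p * without_replacement n k (scaled_vec n p) z)"
  proof (rule sum.cong[OF refl])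
    fix p assume "p \<in> ?S"
    then show "(\<Sum>x\<in>?G p. joint_pmf M X n x) =
        empirical_law M n X p * without_replacement n k (scaled_vec n p) z"
      using sum_joint_pmf_freq_class[OF X ex, of "?G p" "scaled_vec n p"]
      by (simp add: empirical_law_eq_sum[OF assms(1,2) X] without_replacement_def)
  qed
  finally show ?thesis .
qed

text \<open>A vanishing product means that \<open>z\<close> contains a letter missing from the
  urn.\<close>

lemma without_replacement_abs_cont:
  fixes l :: "'a::finite \<Rightarrow> nat"
  assumes "k \<le> n" "n > 0" "(\<Prod>j=1..k. real (l (z j)) / real n) = 0"
  shows "without_replacement n k l z = 0"
proof (rule without_replacement_eq_0[OF _ assms(1)])
  obtain j where j: "j \<in> {1..k}" "l (z j) = 0" using assms(2,3) by auto
  then have "letter_count {1..k} z (z j) > 0" by (auto simp: letter_count_def card_gt_0_iff)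
  with j show "\<not> letter_count {1..k} z \<le> l" by (metis le_fun_def not_le)
qed

section \<open>Divergence of the mixtures, its average bound and the maximum\<close>

theorem proposition1p3:
  fixes M :: "'w measure"
    and X :: "nat \<Rightarrow> 'w \<Rightarrow> 'a::finite"
    and n k :: nat
    and \<mu> :: "'a pmf \<Rightarrow> real"
  assumes "CARD('a) \<ge> 2"
    and "prob_space M"
    and "\<And>i. i \<in> {1..n} \<Longrightarrow> X i \<in> measurable M (count_space UNIV)"
    and "exchangeable M n X"
    and "\<mu> = empirical_law M n X"
    and "1 \<le> k" and "k \<le> n"
  shows "rel_entropy ({1..k} \<rightarrow>\<^sub>E UNIV) (joint_pmf M X k) (iid_mixture k \<mu>)
           \<le> (\<Sum>p\<in>mass_supp \<mu>. ereal (\<mu> p) * D_hyp_mult n k (scaled_vec n p))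
         \<and> (\<Sum>p\<in>mass_supp \<mu>. ereal (\<mu> p) * D_hyp_mult n k (scaled_vec n p))
           \<le> Max (D_hyp_mult n k ` supp_counts n \<mu>)"
proof
  have X: "\<forall>i\<in>{1..n}. X i \<in> measurable M (count_space UNIV)" using assms(3) by blast
  note \<mu> = assms(5)
  have n: "n > 0" using assms(6,7) by simp
  let ?S = "mass_supp \<mu>" and ?Z = "{1..k} \<rightarrow>\<^sub>E (UNIV :: 'a set)"
  define h where "h p = without_replacement n k (scaled_vec n p)" for p :: "'a pmf"
  define q where "q p z = (\<Prod>j=1..k. pmf p (z j))" for p :: "'a pmf" and z
  \<comment> \<open>A real-valued form of \<open>D_hyp_mult\<close> on the support, so that the
    averaging takes place in the reals.\<close>
  define d where "d p = (\<Sum>z\<in>?Z. h p z * ln (h p z / q p z))" for p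
  have finS: "finite ?S" unfolding \<mu> by (rule finite_mass_supp_empirical_law)
  have \<mu>_nonneg: "\<mu> p \<ge> 0" for p by (simp add: \<mu> empirical_law_def)
  have \<mu>_sum: "sum \<mu> ?S = 1" unfolding \<mu> using X by (intro sum_empirical_law[OF assms(2) n]) auto
  have h_nonneg: "h p z \<ge> 0" for p z by (simp add: h_def without_replacement_def)
  have q_nonneg: "q p z \<ge> 0" for p z by (simp add: q_def prod_nonneg)
  have q: "(\<Prod>j=1..k. real (scaled_vec n p (z j)) / real n) = q p z" if "p \<in> ?S" for p z
    using that n by (simp add: q_def scaled_vec_exact \<mu>)
  have ac: "h p z = 0" if "p \<in> ?S" "q p z = 0" for p z
    using without_replacement_abs_cont[OF assms(7) n, of "scaled_vec n p" z] that
    unfolding q[OF that(1)] h_def by blast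
  have D: "D_hyp_mult n k (scaled_vec n p) = ereal (d p)" if "p \<in> ?S" for p
  proof -
    have "sum (scaled_vec n p) UNIV = n"
      using sum_scaled_vec_empirical_law[OF n] that by (simp add: \<mu>)
    then show ?thesis
      using D_hyp_mult_sequences[OF _ assms(7) n, of "scaled_vec n p"]
      unfolding d_def h_def q[OF that] by blast
  qed
  have "(\<Sum>p\<in>?S. ereal (\<mu> p) * D_hyp_mult n k (scaled_vec n p)) = (\<Sum>p\<in>?S. ereal (\<mu> p * d p))"
    by (rule sum.cong[OF refl]) (simp add: D)
  then have avg: "(\<Sum>p\<in>?S. ereal (\<mu> p) * D_hyp_mult n k (scaled_vec n p)) = ereal (\<Sum>p\<in>?S. \<mu> p * d p)"
    by (simp add: sum_ereal)
  have P: "joint_pmf M X k z = (\<Sum>p\<in>?S. \<mu> p * h p z)" for z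
    unfolding h_def \<mu> by (rule joint_pmf_eq_mixture[OF assms(2) n assms(7) X assms(4)])
  have Q: "iid_mixture k \<mu> z = (\<Sum>p\<in>?S. \<mu> p * q p z)" for z
    by (simp add: iid_mixture_def q_def)
  show "rel_entropy ?Z (joint_pmf M X k) (iid_mixture k \<mu>)
      \<le> (\<Sum>p\<in>?S. ereal (\<mu> p) * D_hyp_mult n k (scaled_vec n p))"
  proof -
    have \<mu>_pos: "\<mu> p > 0" if "p \<in> ?S" for p
      using that \<mu>_nonneg[of p] by (simp add: mass_supp_def)
    \<comment> \<open>A zero of the mixture forces \<open>q p z = 0\<close> for all \<open>p\<close>
      in the support, as the weights there are positive. Then every \<open>h p z\<close> vanishes
      too, and \<open>rel_entropy\<close> is finite.\<close>
    have "joint_pmf M X k z = 0" if "iid_mixture k \<mu> z = 0" for z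
    proof -
      have "\<forall>p\<in>?S. \<mu> p * q p z = 0"
        using that \<mu>_nonneg q_nonneg by (subst (asm) Q, subst (asm) sum_nonneg_eq_0_iff[OF finS]) auto
      then have "\<forall>p\<in>?S. h p z = 0" using \<mu>_pos ac by force
      then show ?thesis by (simp add: P)
    qed
    then have "rel_entropy ?Z (joint_pmf M X k) (iid_mixture k \<mu>) =
        ereal (\<Sum>z\<in>?Z. joint_pmf M X k z * ln (joint_pmf M X k z / iid_mixture k \<mu> z))"
      by (auto simp: rel_entropy_def)
    \<comment> \<open>The log-sum inequality is applied for each \<open>z\<close>, with index
      \<open>p\<close> and masses \<open>\<mu> p * h p z\<close> and
      \<open>\<mu> p * q p z\<close>.\<close>
    also have "(\<Sum>z\<in>?Z. joint_pmf M X k z * ln (joint_pmf M X k z / iid_mixture k \<mu> z)) \<le>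
        (\<Sum>z\<in>?Z. \<Sum>p\<in>?S. \<mu> p * h p z * ln (\<mu> p * h p z / (\<mu> p * q p z)))"
      unfolding P Q using \<mu>_nonneg h_nonneg q_nonneg ac
      by (intro sum_mono log_sum_inequality) auto
    also have "\<dots> = (\<Sum>z\<in>?Z. \<Sum>p\<in>?S. \<mu> p * (h p z * ln (h p z / q p z)))"
      by (intro sum.cong refl) (use \<mu>_pos in \<open>force simp: mult.assoc\<close>)
    also have "\<dots> = (\<Sum>p\<in>?S. \<mu> p * d p)"
      by (subst sum.swap) (simp add: d_def sum_distrib_left)
    finally show ?thesis unfolding avg by simp
  qed
  \<comment> \<open>Total mass one makes the support nonempty, so the maximum over its finitely many
    count vectors is attained, at some \<open>r\<close>.\<close>
  have "?S \<noteq> {}" using \<mu>_sum by auto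
  moreover have img: "D_hyp_mult n k ` supp_counts n \<mu> = (\<lambda>p. ereal (d p)) ` ?S"
    unfolding \<mu> supp_counts_empirical_law[OF n] image_image by (rule image_cong) (simp_all add: D \<mu>)
  ultimately have "Max (D_hyp_mult n k ` supp_counts n \<mu>) \<in> (\<lambda>p. ereal (d p)) ` ?S"
    unfolding img using finS by (intro Max_in) auto
  then obtain r where r: "r \<in> ?S" "Max (D_hyp_mult n k ` supp_counts n \<mu>) = ereal (d r)"
    by blast
  have "d p \<le> d r" if "p \<in> ?S" for p
  proof -
    have "ereal (d p) \<le> Max ((\<lambda>p. ereal (d p)) ` ?S)" using that finS by (intro Max_ge) auto
    then show ?thesis using r img by simp
  qed
  then have "(\<Sum>p\<in>?S. \<mu> p * d p) \<le> (\<Sum>p\<in>?S. \<mu> p * d r)"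
    using \<mu>_nonneg by (intro sum_mono mult_left_mono) auto
  also have "\<dots> = d r" using \<mu>_sum by (simp add: sum_distrib_right[symmetric])
  finally show "(\<Sum>p\<in>?S. ereal (\<mu> p) * D_hyp_mult n k (scaled_vec n p))
      \<le> Max (D_hyp_mult n k ` supp_counts n \<mu>)"
    unfolding avg r(2) by simp
qed

end
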